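(* Let $n\ge1$, $0\le r\le n+1$, and let $G^r_n$ be any graph obtained from the linear crossed polyomino chain $G_n$ by deleting $r$ of its vertical edges. Then the number of spanning trees of $G^r_n$ is $$\tau(G^r_n)=2^{\,2n+r+2d-10}\cdot3^{\,n-r-d+5},$$ where $d=d_1+d_{n+1}$ and $d_1,d_{n+1}$ are the degrees of vertices $1$ and $n+1$ in $G^r_n$.
   Context: For $n\geq1$, $G_n$ is the simple graph with vertex set $\{1,\ldots,n+1\}\cup\{1',\ldots,(n+1)'\}$ and edge set consisting of the vertical edges $ii'$ for $1\le i\le n+1$ together with, for each $1\le i\le n$, the edges $i(i+1)$, $i'(i+1)'$, $i(i+1)'$, $i'(i+1)$. For $0\le r\le n+1$, $\mathcal{G}^r_n$ is the set of graphs obtained from $G_n$ by deleting exactly $r$ of the vertical edges $ii'$. $\tau(G)$ is the number of spanning trees of $G$. *)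

theory Defs
  imports Complex_Main
begin

text \<open>
  Undirected simple graphs: every edge is a two-element set of vertices.
  The notion \<open>spanning_tree\<close> of the AFP entry \<open>Graph_Theory\<close> is not used because it is about digraphs:
  its forests exclude only directed cycles, so an orientation of an undirected cycle can be a
  "tree", while in a symmetric digraph every edge already forms a cycle of length two.
\<close>

record 'a ugraph =
  verts :: "'a set"
  edges :: "'a set set"

definition simple_graph :: "'a ugraph \<Rightarrow> bool" where
  "simple_graph G \<longleftrightarrow> finite (verts G) \<and> (\<forall>e\<in>edges G. e \<subseteq> verts G \<and> card e = 2)"

definition adjacency :: "'a ugraph \<Rightarrow> ('a \<times> 'a) set" where
  "adjacency G = {(u, v). {u, v} \<in> edges G}"

definition degree :: "'a ugraph \<Rightarrow> 'a \<Rightarrow> nat" where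
  "degree G v = card {e \<in> edges G. v \<in> e}"

definition delete_edges :: "'a ugraph \<Rightarrow> 'a set set \<Rightarrow> 'a ugraph" where
  "delete_edges G S = \<lparr>verts = verts G, edges = edges G - S\<rparr>"

definition connected_graph :: "'a ugraph \<Rightarrow> bool" where
  "connected_graph G \<longleftrightarrow>
     verts G \<noteq> {} \<and> (\<forall>u\<in>verts G. \<forall>v\<in>verts G. (u, v) \<in> (adjacency G)\<^sup>*)"

text \<open>A cycle is given by its vertices in cyclic order, the first one not being repeated at the end.\<close>

definition is_cycle :: "'a ugraph \<Rightarrow> 'a list \<Rightarrow> bool" where
  "is_cycle G vs \<longleftrightarrow>
     3 \<le> length vs \<and> distinct vs \<and> set vs \<subseteq> verts G \<and>
     (\<forall>i<length vs. {vs ! i, vs ! (Suc i mod length vs)} \<in> edges G)"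

definition is_tree :: "'a ugraph \<Rightarrow> bool" where
  "is_tree G \<longleftrightarrow> simple_graph G \<and> connected_graph G \<and> (\<nexists>vs. is_cycle G vs)"

definition spanning_tree :: "'a ugraph \<Rightarrow> 'a ugraph \<Rightarrow> bool" where
  "spanning_tree T G \<longleftrightarrow> verts T = verts G \<and> edges T \<subseteq> edges G \<and> is_tree T"

definition num_spanning_trees :: "'a ugraph \<Rightarrow> nat" (\<open>\<tau>\<close>) where
  "\<tau> G = card {T. spanning_tree T G}"

text \<open>The vertex \<open>i\<close> is \<open>Unprimed i\<close>, the vertex \<open>i'\<close> is \<open>Primed i\<close>.\<close>

datatype chain_vertex = Unprimed nat | Primed nat

definition vertical_edges :: "nat \<Rightarrow> chain_vertex set set" where
  "vertical_edges n = {{Unprimed i, Primed i} | i. i \<in> {1..n + 1}}"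

definition crossed_chain :: "nat \<Rightarrow> chain_vertex ugraph" where
  "crossed_chain n =
     \<lparr>verts = Unprimed ` {1..n + 1} \<union> Primed ` {1..n + 1},
      edges = vertical_edges n \<union>
        (\<Union>i\<in>{1..n}. {{Unprimed i, Unprimed (i + 1)}, {Primed i, Primed (i + 1)},
                      {Unprimed i, Primed (i + 1)}, {Primed i, Unprimed (i + 1)}})\<rparr>"

definition reduced_chains :: "nat \<Rightarrow> nat \<Rightarrow> chain_vertex ugraph set" where
  "reduced_chains n r =
     {delete_edges (crossed_chain n) S | S. S \<subseteq> vertical_edges n \<and> card S = r}"

lemma simple_graph_crossed_chain: "simple_graph (crossed_chain n)"
  by (auto simp: simple_graph_def crossed_chain_def vertical_edges_def)

lemma simple_graph_reduced_chains: "G \<in> reduced_chains n r \<Longrightarrow> simple_graph G"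
  using simple_graph_crossed_chain[of n]
  by (fastforce simp: reduced_chains_def delete_edges_def simple_graph_def)

end

theory Submission
  imports Defs
begin

text \<open>
  Count, besides spanning trees, the forests in which each component contains exactly one of a
  prescribed set of roots. If a new vertex \<open>w\<close> is joined to a set \<open>N\<close> of old vertices, then removing
  a root \<open>w\<close> turns its chosen neighbours into roots. So let \<open>T k\<close> and \<open>F k\<close> be the numbers of spanning
  trees and of two-component forests separating \<open>k + 1\<close> from \<open>(k + 1)'\<close> in the chain of length \<open>k\<close>.
  Adding the last two vertices gives \<open>T (k + 1) = 4 (1 + v) (T k + F k)\<close> and
  \<open>F (k + 1) = 4 (T k + F k)\<close>, where \<open>v \<in> {0, 1}\<close> is the number of new vertical edges. Hence \<open>T + F\<close> is
  multiplied by 8 or 12 at every inner level, and the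
  count is a product of powers of 2 and 3. The degrees \<open>d\<^sub>1\<close> and \<open>d\<^bsub>n+1\<^esub>\<close> record whether the two
  outer vertical edges are present.
\<close>

section \<open>Reachability from a set of roots, and its bound by the number of edges\<close>

definition reach :: "'a set set \<Rightarrow> 'a set \<Rightarrow> 'a set" where
  "reach A R = {(u, v). {u, v} \<in> A}\<^sup>* `` R"

lemma reach_base: "r \<in> R \<Longrightarrow> r \<in> reach A R"
  by (auto simp: reach_def)

lemma reach_step: "u \<in> reach A R \<Longrightarrow> {u, v} \<in> A \<Longrightarrow> v \<in> reach A R"
  by (auto simp: reach_def intro: rtrancl_into_rtrancl)

text \<open>Induction along paths in closure form: to bound \<open>reach\<close> from above it
  suffices to exhibit a superset of the roots that is closed under edges.\<close>

lemma reach_least: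
  assumes "R \<subseteq> X" and "\<And>u v. u \<in> X \<Longrightarrow> {u, v} \<in> A \<Longrightarrow> v \<in> X"
  shows "reach A R \<subseteq> X"
proof
  fix v assume "v \<in> reach A R"
  then obtain r where "r \<in> R" and "(r, v) \<in> {(u, v). {u, v} \<in> A}\<^sup>*"
    by (auto simp: reach_def)
  from this(2,1) show "v \<in> X"
    by (induction rule: rtrancl_induct) (use assms in auto)
qed

lemma reach_subset: "A \<subseteq> B \<Longrightarrow> R \<subseteq> reach B S \<Longrightarrow> reach A R \<subseteq> reach B S"
  by (rule reach_least) (auto intro: reach_step)

lemma reach_mono: "A \<subseteq> B \<Longrightarrow> R \<subseteq> S \<Longrightarrow> reach A R \<subseteq> reach B S"
  by (rule reach_subset) (auto intro: reach_base)

lemma reach_empty [simp]: "reach {} R = R"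
  by (auto simp: reach_def)

lemma reach_sym:
  assumes "u \<in> reach A {v}"
  shows "v \<in> reach A {u}"
proof -
  have "sym {(u, v). {u, v} \<in> A}"
    by (auto simp: sym_def insert_commute)
  from symD[OF sym_rtrancl[OF this]] assms show ?thesis
    by (auto simp: reach_def)
qed

lemma reach_reroot:
  assumes "v \<in> reach A {u}"
  shows "reach A {v} = reach A {u}"
  using reach_subset[of A A "{v}" "{u}"] reach_subset[of A A "{u}" "{v}"] assms reach_sym[OF assms]
  by auto

lemma reach_insert_edge:
  obtains z where "reach (insert {x, y} A) R \<subseteq> reach A (insert z R)"
proof -
  consider (x) "x \<in> reach A R" | (y) "y \<in> reach A R" | (none) "x \<notin> reach A R" "y \<notin> reach A R"
    by blast
  then show ?thesis
  proof cases
    case x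
    then have "x \<in> reach A (insert y R)" "y \<in> reach A (insert y R)"
      using reach_mono[of A A R "insert y R"] by (auto intro: reach_base)
    then have "reach (insert {x, y} A) R \<subseteq> reach A (insert y R)"
      by (intro reach_least) (auto intro: reach_base reach_step simp: doubleton_eq_iff)
    then show ?thesis by (rule that)
  next
    case y
    then have "x \<in> reach A (insert x R)" "y \<in> reach A (insert x R)"
      using reach_mono[of A A R "insert x R"] by (auto intro: reach_base)
    then have "reach (insert {x, y} A) R \<subseteq> reach A (insert x R)"
      by (intro reach_least) (auto intro: reach_base reach_step simp: doubleton_eq_iff)
    then show ?thesis by (rule that)
  next
    case none
    then have "reach (insert {x, y} A) R \<subseteq> reach A R"
      by (intro reach_least) (auto intro: reach_base reach_step simp: doubleton_eq_iff)
    also have "\<dots> \<subseteq> reach A (insert x R)"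
      by (rule reach_mono) auto
    finally show ?thesis by (rule that)
  qed
qed

text \<open>Edges are traded for roots one at a time with \<open>reach_insert_edge\<close>; once no
  edge is left, only the roots themselves are reachable.\<close>

lemma card_reach_le:
  assumes "finite A" and "\<And>e. e \<in> A \<Longrightarrow> card e = 2" and "finite R"
  shows "finite (reach A R) \<and> card (reach A R) \<le> card A + card R"
  using assms
proof (induction A arbitrary: R rule: finite_induct)
  case empty
  then show ?case by simp
next
  case (insert e A)
  then obtain x y where e: "e = {x, y}"
    by (metis card_2_iff insertI1)
  obtain z where z: "reach (insert e A) R \<subseteq> reach A (insert z R)"
    unfolding e by (rule reach_insert_edge)
  have IH: "finite (reach A (insert z R))" "card (reach A (insert z R)) \<le> card A + card (insert z R)"
    using insert.IH[of "insert z R"] insert.prems by auto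
  have "card (insert z R) \<le> Suc (card R)"
    using insert.prems by (simp add: card_insert_if)
  with IH z insert.hyps show ?case
    using card_mono[OF IH(1) z] by (auto intro: finite_subset)
qed

section \<open>Rooted forests and their number\<close>

text \<open>The edge count stands in for acyclicity and for the roots lying in different components:
  by \<open>card_reach_le\<close>, this is the smallest number of edges that can join every vertex to a root.\<close>

definition rooted_forest :: "'a set \<Rightarrow> 'a set set \<Rightarrow> 'a set \<Rightarrow> bool" where
  "rooted_forest V A R \<longleftrightarrow> V \<subseteq> reach A R \<and> card A + card R = card V"

definition num_forests :: "'a set \<Rightarrow> 'a set set \<Rightarrow> 'a set \<Rightarrow> nat" where
  "num_forests V E R = card {A. A \<subseteq> E \<and> rooted_forest V A R}"

definition edges_on :: "'a set \<Rightarrow> 'a set set" where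
  "edges_on V = {e. e \<subseteq> V \<and> card e = 2}"

lemma finite_edges_on: "finite V \<Longrightarrow> finite (edges_on V)"
  unfolding edges_on_def by (rule finite_subset[of _ "Pow V"]) auto

lemma card_le_if_spanning:
  assumes "finite V" "A \<subseteq> edges_on V" "finite R" "V \<subseteq> reach A R"
  shows "card V \<le> card A + card R"
proof -
  have "finite A"
    using assms finite_edges_on finite_subset by blast
  then have "finite (reach A R) \<and> card (reach A R) \<le> card A + card R"
    by (rule card_reach_le) (use assms in \<open>auto simp: edges_on_def\<close>)
  then show ?thesis
    using card_mono[of "reach A R" V] assms(4) by linarith
qed

lemma rooted_forest_reroot:
  assumes "u \<in> V" "v \<in> V"
  shows "rooted_forest V A {u} \<longleftrightarrow> rooted_forest V A {v}"
  using reach_reroot[of v A u] reach_reroot[of u A v] assms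
  unfolding rooted_forest_def by auto

lemma num_forests_reroot: "u \<in> V \<Longrightarrow> v \<in> V \<Longrightarrow> num_forests V E {u} = num_forests V E {v}"
  unfolding num_forests_def using rooted_forest_reroot[of u V v] by simp

text \<open>Discards the term of the empty root set when the root of a tree is removed and the
  choices of its neighbours are summed.\<close>

lemma num_forests_no_root: "finite V \<Longrightarrow> V \<noteq> {} \<Longrightarrow> num_forests V E {} = 0"
  by (simp add: num_forests_def rooted_forest_def reach_def)

section \<open>Attaching a new vertex to a graph\<close>

definition star :: "'a \<Rightarrow> 'a set \<Rightarrow> 'a set set" where
  "star w M = (\<lambda>x. {w, x}) ` M"

lemma card_Un_star:
  assumes "finite V" "w \<notin> V" "A \<subseteq> edges_on V" "M \<subseteq> V"
  shows "card (A \<union> star w M) = card A + card M"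
proof -
  have "card (star w M) = card M"
    unfolding star_def by (rule card_image) (auto simp: inj_on_def doubleton_eq_iff)
  moreover have "A \<inter> star w M = {}"
    using assms by (auto simp: edges_on_def star_def)
  moreover have "finite A" "finite M"
    using assms finite_edges_on finite_subset by blast+
  ultimately show ?thesis
    by (simp add: card_Un_disjoint star_def)
qed

lemma star_iff: "{u, v} \<in> star w M \<longleftrightarrow> u = w \<and> v \<in> M \<or> v = w \<and> u \<in> M"
  by (auto simp: star_def doubleton_eq_iff)

lemma edges_on_outside: "w \<notin> V \<Longrightarrow> A \<subseteq> edges_on V \<Longrightarrow> {w, x} \<notin> A \<and> {x, w} \<notin> A"
  by (auto simp: edges_on_def)

text \<open>Once the root \<open>w\<close> is removed, its neighbours \<open>M\<close> must take
  over as roots of the parts they led to. A neighbour that lies in \<open>R\<close> would have put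
  two roots into one component.\<close>

lemma rooted_forest_star_root:
  assumes V: "finite V" "w \<notin> V" and A: "A \<subseteq> edges_on V" and sub: "M \<subseteq> V" "R \<subseteq> V"
  shows "rooted_forest (insert w V) (A \<union> star w M) (insert w R) \<longleftrightarrow>
    R \<inter> M = {} \<and> rooted_forest V A (R \<union> M)"
proof -
  let ?B = "A \<union> star w M"
  have fin: "finite M" "finite R"
    using V sub finite_subset by blast+
  have card: "card ?B = card A + card M" "card (insert w V) = Suc (card V)"
    "card (insert w R) = Suc (card R)"
    using card_Un_star[OF V A sub(1)] V sub fin by (auto simp: card_insert_if)
  have cardRM: "card (R \<union> M) + card (R \<inter> M) = card R + card M"
    using card_Un_Int[OF fin(2,1)] by simp
  have "reach ?B (insert w R) \<subseteq> insert w (reach A (R \<union> M))"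
    by (rule reach_least) (auto simp: star_iff edges_on_outside[OF V(2) A] intro: reach_base reach_step)
  moreover have "reach A (R \<union> M) \<subseteq> reach ?B (insert w R)"
    by (rule reach_subset)
      (auto simp: star_iff edges_on_outside[OF V(2) A] intro: reach_base reach_step[of w, OF reach_base])
  moreover have "w \<in> reach ?B (insert w R)"
    by (simp add: reach_base)
  ultimately have conn: "insert w V \<subseteq> reach ?B (insert w R) \<longleftrightarrow> V \<subseteq> reach A (R \<union> M)"
    using V(2) by blast
  \<comment> \<open>The forest equation reads \<open>card A + card M + card R = card V\<close>.
    Spanning gives \<open>card V\<close> as a lower bound of
    \<open>card A + card (R \<union> M)\<close>, so no cardinality can be lost to overlap.\<close>
  have "card V \<le> card A + card (R \<union> M)" if "V \<subseteq> reach A (R \<union> M)"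
    using card_le_if_spanning[OF V(1) A _ that] fin by simp
  moreover have "R \<inter> M = {} \<longleftrightarrow> card (R \<inter> M) = 0"
    using fin by simp
  ultimately show ?thesis
    unfolding rooted_forest_def conn card using cardRM by linarith
qed

text \<open>Every neighbour of \<open>w\<close> is a root here, so edges at \<open>w\<close> reach
  nothing new among the old vertices. Two of them would connect two roots, and none would leave
  \<open>w\<close> unreached.\<close>

lemma rooted_forest_star_leaf:
  assumes V: "finite V" "w \<notin> V" and A: "A \<subseteq> edges_on V" and sub: "M \<subseteq> R" "R \<subseteq> V"
  shows "rooted_forest (insert w V) (A \<union> star w M) R \<longleftrightarrow> card M = 1 \<and> rooted_forest V A R"
proof -
  let ?B = "A \<union> star w M"
  have fin: "finite M" "finite R"
    using V sub by (auto intro: finite_subset)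
  have card: "card ?B = card A + card M" "card (insert w V) = Suc (card V)"
    using card_Un_star[OF V A] V sub fin by (auto simp: card_insert_if)
  have "reach ?B R \<subseteq> insert w (reach A R)"
  proof (rule reach_least)
    show "v \<in> insert w (reach A R)" if "u \<in> insert w (reach A R)" "{u, v} \<in> ?B" for u v
      using that sub reach_step[of u A R v] reach_base[of v R A] edges_on_outside[OF V(2) A]
      by (auto simp: star_iff)
  qed (auto intro: reach_base)
  moreover have "reach A R \<subseteq> reach ?B R"
    by (rule reach_mono) auto
  moreover have "w \<in> reach ?B R \<longleftrightarrow> M \<noteq> {}"
  proof
    assume "M \<noteq> {}"
    then obtain x where "x \<in> M" by blast
    then show "w \<in> reach ?B R"
      using sub by (intro reach_step[OF reach_base, of x]) (auto simp: star_iff)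
  next
    show "M \<noteq> {}" if "w \<in> reach ?B R"
    proof
      assume "M = {}"
      then have "reach ?B R \<subseteq> V"
        by (intro reach_least) (use sub A in \<open>auto simp: star_def edges_on_def\<close>)
      with that V(2) show False by blast
    qed
  qed
  ultimately have conn: "insert w V \<subseteq> reach ?B R \<longleftrightarrow> V \<subseteq> reach A R \<and> card M \<noteq> 0"
    using V(2) fin by auto
  have "card V \<le> card A + card R" if "V \<subseteq> reach A R"
    using card_le_if_spanning[OF V(1) A _ that] fin by simp
  then show ?thesis
    unfolding rooted_forest_def conn card by linarith
qed

text \<open>An edge set of the enlarged graph splits uniquely into old edges and the set
  \<open>M\<close> of chosen neighbours of \<open>w\<close>. The property \<open>P\<close> is kept
  arbitrary to serve both the root and the leaf case.\<close>

lemma card_subsets_Un_star: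
  assumes V: "finite V" "w \<notin> V" and E: "E \<subseteq> edges_on V" and N: "N \<subseteq> V"
  shows "card {B. B \<subseteq> E \<union> star w N \<and> P B} = (\<Sum>M\<in>Pow N. card {A. A \<subseteq> E \<and> P (A \<union> star w M)})"
proof -
  have fin: "finite E" "finite N"
    using V E N finite_edges_on finite_subset by blast+
  let ?S = "SIGMA M:Pow N. {A. A \<subseteq> E \<and> P (A \<union> star w M)}"
  let ?f = "\<lambda>(M, A). A \<union> star w M" and ?g = "\<lambda>B. ({x \<in> N. {w, x} \<in> B}, B \<inter> E)"
  have notE: "{w, x} \<notin> E" for x
    using E V by (auto simp: edges_on_def)
  have split: "B \<inter> E \<union> star w {x \<in> N. {w, x} \<in> B} = B" if "B \<subseteq> E \<union> star w N" for B
    using that by (auto simp: star_def)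
  have "bij_betw ?f ?S {B. B \<subseteq> E \<union> star w N \<and> P B}"
  proof (rule bij_betw_byWitness[where f' = ?g])
    show "\<forall>a\<in>?S. ?g (?f a) = a"
      using notE by (auto simp: star_def doubleton_eq_iff)
    show "\<forall>B\<in>{B. B \<subseteq> E \<union> star w N \<and> P B}. ?f (?g B) = B"
      using split by auto
    show "?f ` ?S \<subseteq> {B. B \<subseteq> E \<union> star w N \<and> P B}"
      by (fastforce simp: star_def)
    show "?g ` {B. B \<subseteq> E \<union> star w N \<and> P B} \<subseteq> ?S"
      using split by auto
  qed
  then have "card {B. B \<subseteq> E \<union> star w N \<and> P B} = card ?S"
    by (simp add: bij_betw_same_card)
  also have "\<dots> = (\<Sum>M\<in>Pow N. card {A. A \<subseteq> E \<and> P (A \<union> star w M)})"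
    using fin by (intro card_SigmaI) auto
  finally show ?thesis .
qed

lemma num_forests_star_root:
  assumes V: "finite V" "w \<notin> V" and E: "E \<subseteq> edges_on V" and N: "N \<subseteq> V" and R: "R \<subseteq> V"
  shows "num_forests (insert w V) (E \<union> star w N) (insert w R) =
    (\<Sum>M\<in>Pow (N - R). num_forests V E (R \<union> M))"
proof -
  have "num_forests (insert w V) (E \<union> star w N) (insert w R) =
      (\<Sum>M\<in>Pow N. card {A. A \<subseteq> E \<and> R \<inter> M = {} \<and> rooted_forest V A (R \<union> M)})"
  proof -
    have "rooted_forest (insert w V) (A \<union> star w M) (insert w R) \<longleftrightarrow>
        R \<inter> M = {} \<and> rooted_forest V A (R \<union> M)" if "A \<subseteq> E" "M \<in> Pow N" for A M
      using that E N by (intro rooted_forest_star_root V R) auto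
    then show ?thesis
      unfolding num_forests_def card_subsets_Un_star[OF V E N]
      by (intro sum.cong refl arg_cong[where f = card] Collect_cong) (simp cong: conj_cong)
  qed
  also have "\<dots> = (\<Sum>M\<in>Pow N. if R \<inter> M = {} then num_forests V E (R \<union> M) else 0)"
    by (intro sum.cong) (auto simp: num_forests_def)
  \<comment> \<open>Only the choices of \<open>M\<close> that avoid \<open>R\<close>
    contribute.\<close>
  also have "\<dots> = (\<Sum>M\<in>Pow (N - R). num_forests V E (R \<union> M))"
    using V N finite_subset[of N V]
    by (intro sum.mono_neutral_cong_right) auto
  finally show ?thesis .
qed

text \<open>The single edge at \<open>w\<close> can be chosen in \<open>card N\<close> ways,
  independently of the forest on the old vertices.\<close>

lemma num_forests_star_leaf:
  assumes V: "finite V" "w \<notin> V" and E: "E \<subseteq> edges_on V" and N: "N \<subseteq> R" and R: "R \<subseteq> V"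
  shows "num_forests (insert w V) (E \<union> star w N) R = card N * num_forests V E R"
proof -
  have fin: "finite N"
    using finite_subset[OF order_trans[OF N R] V(1)] .
  have "num_forests (insert w V) (E \<union> star w N) R =
      (\<Sum>M\<in>Pow N. card {A. A \<subseteq> E \<and> card M = 1 \<and> rooted_forest V A R})"
  proof -
    have "rooted_forest (insert w V) (A \<union> star w M) R \<longleftrightarrow> card M = 1 \<and> rooted_forest V A R"
      if "A \<subseteq> E" "M \<in> Pow N" for A M
      using that E N by (intro rooted_forest_star_leaf V R) auto
    then show ?thesis
      unfolding num_forests_def card_subsets_Un_star[OF V E order_trans[OF N R]]
      by (intro sum.cong refl arg_cong[where f = card] Collect_cong) (simp cong: conj_cong)
  qed
  also have "\<dots> = (\<Sum>M\<in>{M. M \<subseteq> N \<and> card M = 1}. num_forests V E R)"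
    unfolding num_forests_def using fin
    by (intro sum.mono_neutral_cong_right) auto
  also have "\<dots> = card N * num_forests V E R"
    using n_subsets[OF fin, of 1] by simp
  finally show ?thesis .
qed

section \<open>Trees as rooted forests\<close>

text \<open>The ends of simple paths from \<open>x\<close> form a set closed under edges, so
  \<open>reach_least\<close> applies.\<close>

lemma simple_path_exists:
  assumes "y \<in> reach A {x}"
  obtains vs where "vs \<noteq> []" "hd vs = x" "last vs = y" "distinct vs"
    "successively (\<lambda>u v. {u, v} \<in> A) vs"
proof -
  let ?P = "\<lambda>y vs. vs \<noteq> [] \<and> hd vs = x \<and> last vs = y \<and> distinct vs \<and>
    successively (\<lambda>u v. {u, v} \<in> A) vs"
  have "reach A {x} \<subseteq> {y. \<exists>vs. ?P y vs}"
  proof (rule reach_least)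
    have "?P x [x]" by simp
    then have "\<exists>vs. ?P x vs" by (rule exI)
    then show "{x} \<subseteq> {y. \<exists>vs. ?P y vs}" by simp
  next
    fix u v assume "u \<in> {y. \<exists>vs. ?P y vs}" and uv: "{u, v} \<in> A"
    then obtain vs where vs: "?P u vs" by auto
    have "\<exists>vs. ?P v vs"
    \<comment> \<open>A vertex already on the path cuts it back to that vertex; a new one extends
      it.\<close>
    proof (cases "v \<in> set vs")
      case True
      then obtain as bs where "vs = as @ v # bs"
        by (auto simp: in_set_conv_decomp)
      then have "?P v (as @ [v])"
        using vs by (auto simp: successively_append_iff hd_append)
      then show ?thesis by (rule exI)
    next
      case False
      then have "?P v (vs @ [v])"
        using vs uv by (auto simp: successively_append_iff)
      then show ?thesis by (rule exI)
    qed
    then show "v \<in> {y. \<exists>vs. ?P y vs}" by simp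
  qed
  with assms obtain vs where "?P y vs" by auto
  then show thesis using that[of vs] by simp
qed

text \<open>A simple path from \<open>x\<close> to \<open>y\<close> that avoids the edge between
  them becomes a cycle when closed by that edge.\<close>

lemma is_cycle_closing_edge:
  assumes G: "simple_graph G" and e: "{x, y} \<in> edges G" and y: "y \<in> reach (edges G - {{x, y}}) {x}"
  shows "\<exists>vs. is_cycle G vs"
proof -
  have "x \<noteq> y"
    using G e by (auto simp: simple_graph_def)
  from y obtain vs where vs: "vs \<noteq> []" "hd vs = x" "last vs = y" "distinct vs"
    "successively (\<lambda>u v. {u, v} \<in> edges G - {{x, y}}) vs"
    by (rule simple_path_exists)
  have step: "{vs ! i, vs ! Suc i} \<in> edges G - {{x, y}}" if "Suc i < length vs" for i
    using vs(5) that by (simp add: successively_conv_nth)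
  \<comment> \<open>One vertex would force \<open>x = y\<close>; two vertices would make the path
    the very edge it avoids.\<close>
  have len: "3 \<le> length vs"
  proof (rule ccontr)
    assume "\<not> 3 \<le> length vs"
    then consider "length vs = 1" | "length vs = 2"
      using vs(1) by (fastforce simp: not_le less_Suc_eq numeral_3_eq_3)
    then show False
    proof cases
      case 1
      then show False
        using vs \<open>x \<noteq> y\<close> by (auto simp: length_Suc_conv)
    next
      case 2
      then show False
        using vs step[of 0] by (auto simp: length_Suc_conv numeral_2_eq_2)
    qed
  qed
  have edge: "{vs ! i, vs ! (Suc i mod length vs)} \<in> edges G" if "i < length vs" for i
  proof (cases "Suc i < length vs")
    case True
    then show ?thesis using step by simp
  next
    case False
    with that have "Suc i = length vs"
      by simp
    moreover from this have "i = length vs - 1"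
      by simp
    ultimately show ?thesis
      using vs e by (simp add: hd_conv_nth last_conv_nth insert_commute)
  qed
  have "set vs \<subseteq> verts G"
  proof
    fix v assume "v \<in> set vs"
    then obtain i where "i < length vs" "v = vs ! i"
      by (auto simp: in_set_conv_nth)
    with edge[of i] G show "v \<in> verts G"
      by (auto simp: simple_graph_def)
  qed
  with len vs edge have "is_cycle G vs"
    by (auto simp: is_cycle_def)
  then show ?thesis ..
qed

text \<open>The witness is the edge from the last vertex back to the first; the listed order of the
  cycle is a walk around it.\<close>

lemma closing_edge_of_cycle:
  assumes "is_cycle G vs"
  obtains x y where "{x, y} \<in> edges G" "y \<in> reach (edges G - {{x, y}}) {x}"
proof -
  let ?n = "length vs" and ?x = "hd vs" and ?y = "last vs"
  have vs: "3 \<le> ?n" "distinct vs"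
    and edge: "\<And>i. i < ?n \<Longrightarrow> {vs ! i, vs ! (Suc i mod ?n)} \<in> edges G"
    using assms by (auto simp: is_cycle_def)
  have ends: "?x = vs ! 0" "?y = vs ! (?n - 1)"
    using vs(1) hd_conv_nth[of vs] last_conv_nth[of vs] by fastforce+
  have e: "{?x, ?y} \<in> edges G"
  proof -
    have "Suc (?n - 1) = ?n"
      using vs(1) by simp
    then show ?thesis
      using edge[of "?n - 1"] ends by (simp add: insert_commute)
  qed
  have "vs ! i \<in> reach (edges G - {{?x, ?y}}) {?x}" if "i < ?n" for i
    using that
  proof (induction i)
    case 0
    then show ?case by (simp add: ends reach_base)
  next
    case (Suc i)
    \<comment> \<open>By distinctness a consecutive pair can equal the closing pair only if its
      indices are 0 and \<open>?n - 1\<close>, which a length of at least 3 rules out.\<close>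
    have "vs ! i = vs ! 0 \<longleftrightarrow> i = 0" "vs ! Suc i = vs ! (?n - 1) \<longleftrightarrow> Suc i = ?n - 1"
      "vs ! Suc i = vs ! 0 \<longleftrightarrow> Suc i = 0"
      by (rule nth_eq_iff_index_eq[OF vs(2)]; use vs(1) Suc.prems in linarith)+
    moreover have "i = 0 \<Longrightarrow> Suc i \<noteq> ?n - 1"
      using vs(1) by linarith
    ultimately have "{vs ! i, vs ! Suc i} \<noteq> {?x, ?y}"
      unfolding ends doubleton_eq_iff by blast
    moreover have "{vs ! i, vs ! Suc i} \<in> edges G"
      using edge[of i] Suc.prems by simp
    ultimately show ?case
      using Suc by (intro reach_step[OF Suc.IH]) simp_all
  qed
  from this[of "?n - 1"] vs(1) ends e show thesis
    by (intro that[of ?x ?y]) auto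
qed

lemma rooted_forest_exists:
  assumes "finite V" "A \<subseteq> edges_on V" "\<And>x y. {x, y} \<in> A \<Longrightarrow> y \<notin> reach (A - {{x, y}}) {x}"
  shows "\<exists>R\<subseteq>V. rooted_forest V A R"
proof -
  have "finite A"
    using assms finite_edges_on finite_subset by blast
  then show ?thesis
    using assms(2,3)
  proof (induction A rule: finite_induct)
    case empty
    show ?case by (auto simp: rooted_forest_def)
  next
    case (insert e A)
    have "\<exists>R\<subseteq>V. rooted_forest V A R"
    proof (rule insert.IH)
      fix x y assume "{x, y} \<in> A"
      then have "y \<notin> reach (insert e A - {{x, y}}) {x}"
        using insert.prems(2) by blast
      then show "y \<notin> reach (A - {{x, y}}) {x}"
        using reach_mono[of "A - {{x, y}}" "insert e A - {{x, y}}" "{x}" "{x}"] by blast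
    qed (use insert.prems in auto)
    then obtain R where R: "R \<subseteq> V" "V \<subseteq> reach A R" "card A + card R = card V"
      by (auto simp: rooted_forest_def)
    have "card e = 2" "e \<subseteq> V"
      using insert.prems by (auto simp: edges_on_def)
    then obtain x y where e: "e = {x, y}" "x \<in> V" "y \<in> V"
      by (auto simp: card_2_iff)
    have sep: "y \<notin> reach A {x}"
      using insert.prems(2)[of x y] insert.hyps e by auto
    obtain r s where rs: "r \<in> R" "x \<in> reach A {r}" "s \<in> R" "y \<in> reach A {s}"
      using R(2) e unfolding reach_def by blast
    have "r \<noteq> s"
      using rs sep reach_reroot[of x A r] by auto
    \<comment> \<open>The dropped root \<open>s\<close> is still reached: from \<open>r\<close> to
      \<open>x\<close>, across the new edge to \<open>y\<close>, and on to \<open>s\<close>.\<close>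
    have "reach A R \<subseteq> reach (insert e A) (R - {s})"
    proof (rule reach_subset)
      have "x \<in> reach (insert e A) (R - {s})"
        using reach_mono[of A "insert e A" "{r}" "R - {s}"] rs \<open>r \<noteq> s\<close> by auto
      then have "y \<in> reach (insert e A) (R - {s})"
        by (rule reach_step) (simp add: e)
      moreover have "s \<in> reach (insert e A) {y}"
        using reach_sym[OF rs(4)] reach_mono[of A "insert e A" "{y}" "{y}"] by auto
      ultimately have "s \<in> reach (insert e A) (R - {s})"
        using reach_subset[of "insert e A" "insert e A" "{y}" "R - {s}"] by auto
      then show "R \<subseteq> reach (insert e A) (R - {s})"
        by (auto intro: reach_base)
    qed auto
    moreover have "card (insert e A) + card (R - {s}) = card V"
      using R rs(3) insert.hyps finite_subset[OF R(1) assms(1)] card_gt_0_iff[of R] by auto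
    ultimately have "rooted_forest V (insert e A) (R - {s})"
      using R(2) by (auto simp: rooted_forest_def)
    then show ?case
      using R(1) by blast
  qed
qed

lemma simple_graph_iff: "simple_graph G \<longleftrightarrow> finite (verts G) \<and> edges G \<subseteq> edges_on (verts G)"
  by (auto simp: simple_graph_def edges_on_def)

lemma connected_graph_iff:
  assumes "r \<in> verts G"
  shows "connected_graph G \<longleftrightarrow> verts G \<subseteq> reach (edges G) {r}"
proof
  assume "connected_graph G"
  then show "verts G \<subseteq> reach (edges G) {r}"
    using assms by (auto simp: connected_graph_def reach_def adjacency_def)
next
  assume "verts G \<subseteq> reach (edges G) {r}"
  then have "v \<in> reach (edges G) {u}" if "u \<in> verts G" "v \<in> verts G" for u v
    using that reach_reroot[of u "edges G" r] by auto
  then show "connected_graph G"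
    using assms by (auto simp: connected_graph_def reach_def adjacency_def)
qed

text \<open>An acyclic graph has a root set matching its edge count, and this set is nonempty;
  connectedness supplies the opposite bound, so there is just one root. Conversely, a cycle would
  contain an edge whose removal preserves connectedness, leaving fewer edges than
  \<open>card_le_if_spanning\<close> permits.\<close>

lemma is_tree_iff_rooted_forest:
  assumes G: "simple_graph G" and r: "r \<in> verts G"
  shows "is_tree G \<longleftrightarrow> rooted_forest (verts G) (edges G) {r}"
proof
  have fin: "finite (verts G)" and E: "edges G \<subseteq> edges_on (verts G)"
    using G by (auto simp: simple_graph_iff)
  {
    assume tree: "is_tree G"
    then have conn: "verts G \<subseteq> reach (edges G) {r}"
      using r by (auto simp: is_tree_def connected_graph_iff)
    have "\<exists>R\<subseteq>verts G. rooted_forest (verts G) (edges G) R"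
      by (rule rooted_forest_exists[OF fin E])
        (use tree is_cycle_closing_edge[OF G] in \<open>auto simp: is_tree_def\<close>)
    then obtain R where R: "R \<subseteq> verts G" "verts G \<subseteq> reach (edges G) R"
      "card (edges G) + card R = card (verts G)"
      by (auto simp: rooted_forest_def)
    have "R \<noteq> {}"
      using R(2) r by (auto simp: reach_def)
    then have "card R > 0"
      using finite_subset[OF R(1) fin] by (simp add: card_gt_0_iff)
    then show "rooted_forest (verts G) (edges G) {r}"
      using card_le_if_spanning[OF fin E _ conn] conn R(3) by (simp add: rooted_forest_def)
  next
    assume forest: "rooted_forest (verts G) (edges G) {r}"
    then have conn: "verts G \<subseteq> reach (edges G) {r}"
      and card: "card (edges G) + 1 = card (verts G)"
      by (auto simp: rooted_forest_def)
    have "\<not> is_cycle G vs" for vs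
    proof
      assume "is_cycle G vs"
      then obtain x y where e: "{x, y} \<in> edges G" and y: "y \<in> reach (edges G - {{x, y}}) {x}"
        by (rule closing_edge_of_cycle)
      let ?A = "edges G - {{x, y}}"
      have x: "x \<in> verts G"
        using e E by (auto simp: edges_on_def)
      \<comment> \<open>Both ends of the removed edge remain reachable from \<open>x\<close>, so no
        use of that edge is missed.\<close>
      have "reach (edges G) {x} \<subseteq> reach ?A {x}"
      proof (rule reach_least)
        fix u v assume "u \<in> reach ?A {x}" "{u, v} \<in> edges G"
        then show "v \<in> reach ?A {x}"
          using y reach_step[of u ?A "{x}" v]
          by (cases "{u, v} = {x, y}") (auto simp: doubleton_eq_iff intro: reach_base)
      qed (auto intro: reach_base)
      then have "verts G \<subseteq> reach ?A {x}"
        using conn x reach_reroot[of x "edges G" r] by auto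
      then have "card (verts G) \<le> card ?A + 1"
        using card_le_if_spanning[OF fin, of ?A "{x}"] E by auto
      moreover have "card ?A < card (edges G)"
        using e finite_subset[OF E finite_edges_on[OF fin]] by (intro psubset_card_mono) auto
      ultimately show False
        using card by simp
    qed
    then show "is_tree G"
      using G conn r by (auto simp: is_tree_def connected_graph_iff)
  }
qed

text \<open>With the vertex set fixed, a spanning tree is determined by its edges, so trees and edge
  sets correspond bijectively.\<close>

lemma num_spanning_trees_eq_num_forests:
  assumes G: "simple_graph G" and r: "r \<in> verts G"
  shows "\<tau> G = num_forests (verts G) (edges G) {r}"
proof -
  let ?graph = "\<lambda>A. \<lparr>verts = verts G, edges = A\<rparr>"
  have tree: "is_tree (?graph A) \<longleftrightarrow> rooted_forest (verts G) A {r}" if "A \<subseteq> edges G" for A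
    using is_tree_iff_rooted_forest[of "?graph A" r] G r that by (auto simp: simple_graph_iff)
  have tree_T: "is_tree T \<longleftrightarrow> rooted_forest (verts G) (edges T) {r}"
    if "verts T = verts G" "edges T \<subseteq> edges G" for T :: "'a ugraph"
    using tree[OF that(2)] that(1) by (cases T) simp
  have "bij_betw edges {T. spanning_tree T G} {A. A \<subseteq> edges G \<and> rooted_forest (verts G) A {r}}"
    by (rule bij_betw_byWitness[where f' = ?graph])
      (use tree tree_T in \<open>auto simp: spanning_tree_def\<close>)
  then show ?thesis
    by (simp add: num_spanning_trees_def num_forests_def bij_betw_same_card)
qed

section \<open>Extending a chain by one level\<close>

text \<open>First \<open>b'\<close> and then \<open>b\<close> is stripped off. What remains are
  counts on \<open>V\<close> with roots among \<open>a\<close> and \<open>a'\<close>: by symmetry of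
  rerooting these are only \<open>t = num_forests V E {a}\<close> and
  \<open>f = num_forests V E {a, a'}\<close>, and zero for no root.\<close>

lemma num_forests_add_level:
  fixes a a' b b' :: 'a and v :: bool
  assumes V: "finite V" "a \<in> V" "a' \<in> V" "a \<noteq> a'" and b: "b \<notin> V" "b' \<notin> V" "b \<noteq> b'"
    and E: "E \<subseteq> edges_on V"
  defines "W \<equiv> insert b' (insert b V)"
    and "D \<equiv> E \<union> star b {a, a'} \<union> star b' ({a, a'} \<union> (if v then {b} else {}))"
    and "s \<equiv> num_forests V E {a} + num_forests V E {a, a'}"
  shows "num_forests W D {b'} = (if v then 8 else 4) * s" and "num_forests W D {b', b} = 4 * s"
proof -
  let ?V = "insert b V" and ?E = "E \<union> star b {a, a'}"
  have V': "finite ?V" "b' \<notin> ?V" and E': "?E \<subseteq> edges_on ?V"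
    using V b E by (auto simp: edges_on_def star_def card_insert_if)
  have ne: "a \<noteq> b" "a' \<noteq> b" "b \<noteq> a" "b \<noteq> a'" "a' \<noteq> a"
    using V b by auto
  have swap: "num_forests V E {a'} = num_forests V E {a}"
    using V by (intro num_forests_reroot) auto
  note [simp] = swap num_forests_no_root[OF V(1)] num_forests_no_root[OF V'(1)]
  have V_ne: "V \<noteq> {}" using V by auto
  have root_b: "num_forests ?V ?E (insert b Q) = (\<Sum>M\<in>Pow ({a, a'} - Q). num_forests V E (Q \<union> M))"
    if "Q \<subseteq> {a, a'}" for Q
    using V b E that by (intro num_forests_star_root) auto
  have b0: "num_forests ?V ?E {b} = 2 * num_forests V E {a} + num_forests V E {a, a'}"
    using root_b[of "{}"] V(4) ne V_ne by (simp add: Pow_insert insert_commute)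
  have b1: "num_forests ?V ?E {b, a} = s"
    using root_b[of "{a}"] V(4) ne by (simp add: Pow_insert insert_Diff_if insert_commute s_def)
  have b2: "num_forests ?V ?E {b, a'} = s"
    using root_b[of "{a'}"] V(4) ne by (simp add: Pow_insert insert_Diff_if insert_commute s_def)
  have b3: "num_forests ?V ?E {b, a, a'} = num_forests V E {a, a'}"
    using root_b[of "{a, a'}"] by simp
  \<comment> \<open>Here \<open>b\<close> is not a root, but a single root may be moved to
    \<open>b\<close>, where the count is known.\<close>
  have c1: "num_forests ?V ?E {a} = num_forests ?V ?E {b}"
    using V by (intro num_forests_reroot) auto
  have c2: "num_forests ?V ?E {a'} = num_forests ?V ?E {b}"
    using V by (intro num_forests_reroot) auto
  \<comment> \<open>Now both neighbours of \<open>b\<close> are roots, so the leaf count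
    applies.\<close>
  have c3: "num_forests ?V ?E {a, a'} = 2 * num_forests V E {a, a'}"
    using num_forests_star_leaf[OF V(1) b(1) E, of "{a, a'}" "{a, a'}"] V by simp
  have root_b': "num_forests W D (insert b' R) =
      (\<Sum>M\<in>Pow ({a, a'} \<union> (if v then {b} else {}) - R). num_forests ?V ?E (R \<union> M))"
    if "R \<subseteq> {b}" for R
    unfolding W_def D_def using V that by (intro num_forests_star_root V' E') auto
  \<comment> \<open>With \<open>b\<close> a root as well, the edge between \<open>b\<close> and
    \<open>b'\<close> cannot be chosen, so \<open>v\<close> drops out. The sum is
    \<open>(2t + f) + 2(t + f) + f\<close>.\<close>
  have "num_forests W D {b', b} = (\<Sum>M\<in>Pow {a, a'}. num_forests ?V ?E ({b} \<union> M))"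
    using root_b'[of "{b}"] ne by (simp add: insert_Diff_if)
  also have "\<dots> = 4 * s"
    using V(4) ne b0 b1 b2 b3 by (simp add: Pow_insert insert_commute s_def)
  finally show F: "num_forests W D {b', b} = 4 * s" .
  show "num_forests W D {b'} = (if v then 8 else 4) * s"
  proof (cases v)
    case True
    have "num_forests W D {b'} = (\<Sum>M\<in>Pow {b, a, a'}. num_forests ?V ?E M)"
      using root_b'[of "{}"] True by (simp add: insert_commute)
    also have "\<dots> = 8 * s"
    proof -
      \<comment> \<open>The empty set gives 0, the three singletons \<open>2t + f\<close> each,
        \<open>{a, a'}\<close> gives \<open>2f\<close>, the other two pairs \<open>t + f\<close>
        each, and the full set \<open>f\<close>: in total \<open>8t + 8f\<close>.\<close>
      have "Pow {b, a, a'} = {{}, {a}, {a'}, {a, a'}, {b}, {b, a}, {b, a'}, {b, a, a'}}"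
        by (auto simp: Pow_insert)
      then show ?thesis
        using V(4) ne b0 b1 b2 b3 c1 c2 c3
        by (simp add: s_def doubleton_eq_iff insert_eq_iff)
    qed
    finally show ?thesis using True by simp
  next
    case False
    have "num_forests W D {b'} = (\<Sum>M\<in>Pow {a, a'}. num_forests ?V ?E M)"
      using root_b'[of "{}"] False by simp
    also have "\<dots> = 4 * s"
      using V(4) ne b0 c1 c2 c3 by (simp add: Pow_insert s_def)
    finally show ?thesis using False by simp
  qed
qed

text \<open>Start of the recursion: a single level is itself built by attaching \<open>a'\<close> to
  the empty graph and then \<open>a\<close> to \<open>a'\<close>.\<close>

lemma num_forests_one_level:
  fixes a a' :: 'a and v :: bool
  assumes "a \<noteq> a'"
  defines "E \<equiv> star a (if v then {a'} else {})"
  shows "num_forests {a, a'} E {a} = (if v then 1 else 0)" and "num_forests {a, a'} E {a, a'} = 1"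
proof -
  have empty: "num_forests ({} :: 'a set) {} {} = 1"
    by (simp add: num_forests_def rooted_forest_def conj_commute cong: conj_cong)
  have single: "num_forests {a'} {} {a'} = 1"
    using num_forests_star_root[of "{}" a' "{}" "{}" "{}"] empty by (simp add: star_def)
  have root: "num_forests {a, a'} E (insert a R) =
      (\<Sum>M\<in>Pow ((if v then {a'} else {}) - R). num_forests {a'} {} (R \<union> M))"
    if "R \<subseteq> {a'}" for R
    unfolding E_def
    using num_forests_star_root[of "{a'}" a "{}" "if v then {a'} else {}" R] assms(1) that by simp
  show "num_forests {a, a'} E {a} = (if v then 1 else 0)"
    using root[of "{}"] single by (simp add: Pow_insert num_forests_no_root)
  show "num_forests {a, a'} E {a, a'} = 1"
    using root[of "{a'}"] single by simp
qed

section \<open>Reduced crossed chains\<close>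

definition vertical_edge :: "nat \<Rightarrow> chain_vertex set" where
  "vertical_edge i = {Unprimed i, Primed i}"

lemma inj_vertical_edge: "inj_on vertical_edge I"
  by (auto simp: inj_on_def vertical_edge_def doubleton_eq_iff)

lemma vertical_edges_eq: "vertical_edges n = vertical_edge ` {1..n + 1}"
  by (auto simp: vertical_edges_def vertical_edge_def)

lemma verts_reduced_Suc:
  "verts (delete_edges (crossed_chain (Suc k)) S) =
    insert (Primed (k + 2)) (insert (Unprimed (k + 2)) (verts (delete_edges (crossed_chain k) S)))"
  by (simp add: delete_edges_def crossed_chain_def atLeastAtMostSuc_conv insert_commute)

text \<open>Brings the chain into the form required by \<open>num_forests_add_level\<close>. The
  same \<open>S\<close> serves every length \<open>k\<close>, because deleting absent edges changes
  nothing.\<close>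

lemma edges_reduced_Suc:
  assumes "S \<subseteq> vertical_edges n"
  shows "edges (delete_edges (crossed_chain (Suc k)) S) =
    edges (delete_edges (crossed_chain k) S)
      \<union> star (Unprimed (k + 2)) {Primed (k + 1), Unprimed (k + 1)}
      \<union> star (Primed (k + 2)) ({Primed (k + 1), Unprimed (k + 1)} \<union>
          (if vertical_edge (k + 2) \<notin> S then {Unprimed (k + 2)} else {}))"
proof -
  \<comment> \<open>Edges between different levels survive, since \<open>S\<close> consists of
    vertical edges.\<close>
  have "{x, y} \<notin> S" if "x = Primed i \<or> x = Unprimed i" "y = Primed j \<or> y = Unprimed j" "i \<noteq> j"
    for x y i j
    using assms that by (auto simp: vertical_edges_eq vertical_edge_def doubleton_eq_iff)
  note cross = this[of _ "k + 1" _ "k + 2", simplified] this[of _ "k + 2" _ "k + 1", simplified]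
  show ?thesis
    using cross
    by (auto simp: delete_edges_def crossed_chain_def vertical_edges_eq star_def vertical_edge_def
        atLeastAtMostSuc_conv insert_commute)
qed

lemma simple_graph_reduced: "simple_graph (delete_edges (crossed_chain k) S)"
  using simple_graph_crossed_chain[of k] by (auto simp: simple_graph_def delete_edges_def)

text \<open>Here \<open>f\<close> adds the trees and the two-rooted forests. The last level enters
  the number of trees with its tree factor alone, 4 or 8, and therefore stays outside the
  product.\<close>

lemma num_forests_reduced:
  fixes k :: nat
  assumes S: "S \<subseteq> vertical_edges n"
  defines "H \<equiv> \<lambda>k. delete_edges (crossed_chain k) S"
  defines "f \<equiv> \<lambda>k. num_forests (verts (H k)) (edges (H k)) {Primed (k + 1)}
      + num_forests (verts (H k)) (edges (H k)) {Primed (k + 1), Unprimed (k + 1)}"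
  shows "\<tau> (H (Suc k)) = (if vertical_edge (k + 2) \<in> S then 4 else 8) * f k"
    and "f k = (if vertical_edge 1 \<in> S then 1 else 2) *
      (\<Prod>i\<in>{2..k + 1}. if vertical_edge i \<in> S then 8 else 12)"
proof -
  have step: "num_forests (verts (H (Suc k))) (edges (H (Suc k))) {Primed (k + 2)} =
        (if vertical_edge (k + 2) \<notin> S then 8 else 4) * f k"
      "num_forests (verts (H (Suc k))) (edges (H (Suc k))) {Primed (k + 2), Unprimed (k + 2)} = 4 * f k"
    for k
  proof -
    have "finite (verts (H k))" "edges (H k) \<subseteq> edges_on (verts (H k))"
      using simple_graph_reduced[of k S] by (auto simp: simple_graph_iff H_def)
    moreover have "Primed (k + 1) \<in> verts (H k)" "Unprimed (k + 1) \<in> verts (H k)"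
        "Primed (k + 2) \<notin> verts (H k)" "Unprimed (k + 2) \<notin> verts (H k)"
      by (auto simp: H_def delete_edges_def crossed_chain_def)
    ultimately show "num_forests (verts (H (Suc k))) (edges (H (Suc k))) {Primed (k + 2)} =
        (if vertical_edge (k + 2) \<notin> S then 8 else 4) * f k"
      "num_forests (verts (H (Suc k))) (edges (H (Suc k))) {Primed (k + 2), Unprimed (k + 2)} = 4 * f k"
      unfolding f_def
      unfolding H_def verts_reduced_Suc edges_reduced_Suc[OF S]
      by (intro num_forests_add_level; simp)+
  qed
  have "Primed (k + 2) \<in> verts (H (Suc k))"
    by (auto simp: H_def delete_edges_def crossed_chain_def)
  then have "\<tau> (H (Suc k)) = num_forests (verts (H (Suc k))) (edges (H (Suc k))) {Primed (k + 2)}"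
    using simple_graph_reduced unfolding H_def by (intro num_spanning_trees_eq_num_forests)
  then show "\<tau> (H (Suc k)) = (if vertical_edge (k + 2) \<in> S then 4 else 8) * f k"
    using step(1)[of k] by simp
  show "f k = (if vertical_edge 1 \<in> S then 1 else 2) *
      (\<Prod>i\<in>{2..k + 1}. if vertical_edge i \<in> S then 8 else 12)"
  proof (induction k)
    case 0
    \<comment> \<open>The chain of length 0 is the single level 1, whose value of \<open>f\<close>
      is \<open>0 + 1\<close> or \<open>1 + 1\<close>.\<close>
    have "verts (H 0) = {Primed 1, Unprimed 1}"
      "edges (H 0) = star (Primed 1) (if vertical_edge 1 \<notin> S then {Unprimed 1} else {})"
      by (auto simp: H_def delete_edges_def crossed_chain_def vertical_edges_eq vertical_edge_def
          star_def insert_commute)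
    then show ?case
      using num_forests_one_level[of "Primed 1" "Unprimed 1" "vertical_edge 1 \<notin> S"]
      by (simp add: f_def)
  next
    case (Suc k)
    \<comment> \<open>The factors for trees and for two-rooted forests add up: \<open>4 + 4\<close>
      or \<open>8 + 4\<close>.\<close>
    have "f (Suc k) = (if vertical_edge (k + 2) \<in> S then 8 else 12) * f k"
      using step[of k] by (simp add: f_def)
    then show ?case
      unfolding Suc.IH by (simp add: atLeastAtMostSuc_conv)
  qed
qed

section \<open>End degrees and the closed formula\<close>

lemma degree_reduced_first:
  assumes "1 \<le> n" "S \<subseteq> vertical_edges n"
  shows "degree (delete_edges (crossed_chain n) S) (Unprimed 1) =
    (if vertical_edge 1 \<in> S then 2 else 3)"
proof -
  have "{e \<in> edges (delete_edges (crossed_chain n) S). Unprimed 1 \<in> e} =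
      {{Unprimed 1, Unprimed 2}, {Unprimed 1, Primed 2}} \<union>
      (if vertical_edge 1 \<in> S then {} else {vertical_edge 1})"
    using assms
    by (auto simp: delete_edges_def crossed_chain_def vertical_edges_eq vertical_edge_def
        doubleton_eq_iff insert_commute)
  then show ?thesis
    by (simp add: degree_def vertical_edge_def doubleton_eq_iff)
qed

lemma degree_reduced_last:
  assumes "1 \<le> n" "S \<subseteq> vertical_edges n"
  shows "degree (delete_edges (crossed_chain n) S) (Unprimed (n + 1)) =
    (if vertical_edge (n + 1) \<in> S then 2 else 3)"
proof -
  have "{e \<in> edges (delete_edges (crossed_chain n) S). Unprimed (n + 1) \<in> e} =
      {{Unprimed n, Unprimed (n + 1)}, {Primed n, Unprimed (n + 1)}} \<union>
      (if vertical_edge (n + 1) \<in> S then {} else {vertical_edge (n + 1)})"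
    using assms
    by (auto simp: delete_edges_def crossed_chain_def vertical_edges_eq vertical_edge_def
        doubleton_eq_iff insert_commute)
  then show ?thesis
    by (simp add: degree_def vertical_edge_def doubleton_eq_iff)
qed

theorem theorem4p4:
  fixes n r d :: nat and G :: "chain_vertex ugraph"
  assumes "1 \<le> n" and "r \<le> n + 1"
    and "G \<in> reduced_chains n r"
    and "d = degree G (Unprimed 1) + degree G (Unprimed (n + 1))"
  shows "real (\<tau> G) =
    2 powi (2 * int n + int r + 2 * int d - 10) * 3 powi (int n - int r - int d + 5)"
proof -
  obtain S where S: "S \<subseteq> vertical_edges n" "card S = r" and G: "G = delete_edges (crossed_chain n) S"
    using assms(3) by (auto simp: reduced_chains_def)
  obtain m where m: "n = Suc m"
    using assms(1) by (cases n) auto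
  let ?del = "\<lambda>i. vertical_edge i \<in> S"
  \<comment> \<open>The inner levels are counted as kept (\<open>p\<close>) or deleted
    (\<open>q\<close>); \<open>x\<close> and \<open>y\<close> below indicate whether the two outer
    vertical edges are kept. All parameters are then expressed in these four.\<close>
  define p q where "p = card {i \<in> {2..n}. \<not> ?del i}" and "q = card {i \<in> {2..n}. ?del i}"
  define x y :: nat where "x = (if ?del 1 then 0 else 1)" and "y = (if ?del (n + 1) then 0 else 1)"
  have xy: "x \<le> 1" "y \<le> 1"
    by (auto simp: x_def y_def)
  have "card {2..n} = p + q"
    unfolding p_def q_def
    by (subst card_Un_disjoint[symmetric]) (auto simp del: card_atLeastAtMost intro!: arg_cong[where f = card])
  then have n: "n = p + q + 1"
    using assms(1) by simp
  have d: "d = 4 + x + y"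
    using degree_reduced_first[OF assms(1) S(1)] degree_reduced_last[OF assms(1) S(1)]
    unfolding assms(4) G x_def y_def by simp
  \<comment> \<open>Written additively to avoid truncated subtraction: \<open>r\<close> is
    \<open>q\<close> plus the number of deleted outer edges.\<close>
  have r: "r + x + y = q + 2"
  proof -
    have "S = vertical_edge ` {i \<in> {1..n + 1}. ?del i}"
      using S(1) by (auto simp: vertical_edges_eq)
    then have "r = card {i \<in> {1..n + 1}. ?del i}"
      using S(2) card_image[OF inj_vertical_edge] by metis
    also have "{i \<in> {1..n + 1}. ?del i} =
        {i \<in> {2..n}. ?del i} \<union> {i. i = 1 \<and> ?del i} \<union> {i. i = n + 1 \<and> ?del i}"
      using assms(1) by force
    also have "card \<dots> = q + card {i. i = 1 \<and> ?del i} + card {i. i = n + 1 \<and> ?del i}"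
      \<comment> \<open>Since \<open>n\<close> is positive, levels 1 and \<open>n + 1\<close> are
        distinct and the three sets are disjoint.\<close>
      unfolding q_def using assms(1) by (subst card_Un_disjoint; auto)+
    also have "card {i. i = 1 \<and> ?del i} = 1 - x"
      by (auto simp: x_def conj_commute cong: conj_cong)
    also have "card {i. i = n + 1 \<and> ?del i} = 1 - y"
      by (auto simp: y_def conj_commute cong: conj_cong)
    finally show ?thesis
      using xy by simp
  qed
  \<comment> \<open>The factors \<open>4 * 2 ^ y\<close> and \<open>2 ^ x\<close> encode the case
    distinctions at the last and the first level.\<close>
  have "\<tau> G = 4 * 2 ^ y * (2 ^ x * (\<Prod>i\<in>{2..n}. if ?del i then 8 else 12))"
    using num_forests_reduced[OF S(1), of m] unfolding G m x_def y_def by simp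
  also have "(\<Prod>i\<in>{2..n}. if ?del i then 8 else 12) = (8 ^ q * 12 ^ p :: nat)"
    by (simp add: prod.If_cases p_def q_def Int_def)
  also have "(8 :: nat) ^ q = 2 ^ (3 * q)"
    by (simp add: power_mult)
  also have "(12 :: nat) ^ p = (2\<^sup>2 * 3) ^ p"
    by simp
  also have "\<dots> = 2 ^ (2 * p) * 3 ^ p"
    by (simp only: power_mult_distrib power_mult)
  finally have "\<tau> G = 2 ^ (2 * p + 3 * q + 2 + x + y) * 3 ^ p"
    by (simp add: power_add algebra_simps)
  \<comment> \<open>Substituting \<open>n = p + q + 1\<close>, \<open>d = 4 + x + y\<close> and
    \<open>r = q + 2 - x - y\<close> shows that both integer exponents are natural numbers, so the
    integer powers reduce to ordinary ones.\<close>
  moreover have "2 * int n + int r + 2 * int d - 10 = int (2 * p + 3 * q + 2 + x + y)"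
    "int n - int r - int d + 5 = int p"
    using n d r by auto
  ultimately show ?thesis
    by (simp only: power_int_of_nat) simp
qed

end
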